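(* For any integer $n\geq 1$ and any $0<x<\pi$, \[ \left|\sum_{k=1}^n\frac{\sin kx}{k}-\frac{\pi-x}{2}\right|<\operatorname{arccot}\left((2n+1)\sin\frac{x}{2}\right). \] *)

theory Defs
  imports Complex_Main
begin

definition arccot :: "real \<Rightarrow> real" where
  "arccot y = pi / 2 - arctan y"

end

theory Submission
  imports Defs
begin

text \<open>
  Put $c = \sin(x/2)$, $N = 2n+1$, $z = Nc$, and let $R$ be the remainder $\sum_{k>n} \sin(kx)/k$.

  If $z \le 7/5$, compare derivatives: as functions of $y = x/2$, both $R$ and
  $\mathrm{arccot}(N \sin y)$ start at $\pi/2$, and $R$ decreases faster since $R' = -\sin(Ny)/\sin y$;
  the lower bound follows from $|R'| \le N$.

  If $z \ge 7/5$, Abel summation turns $R$ into $H(1) - H(0)$, where $H(t) = \sum_{k>n} t^k \sin(kx)/k$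
  satisfies $|H'(t)| \le t^n / \sqrt{1 - 2t\cos x + t^2}$. With $t = e^{-2v}$ this gives
  $|R| \le \int_0^\infty e^{-Nv} / \sqrt{c^2 + \sinh^2 v}\,dv
    \le \int_0^\infty e^{-zs} / \sqrt{1+s^2}\,ds$.
  The last integral is below $q(0) = 3z/(3z^2+1) < \mathrm{arccot}\,z$, where
  $q(s) = 1/(zr + 1/(3z) + s/(2r))$ and $r = \sqrt{1+s^2}$, because $e^{-zs} q(s)$ decreases at least
  as fast as required: $zq - q' \ge 1/r$. No integral is needed, only monotonicity in $v$ of
  $e^{-Nv} q(\sinh v / c) \pm H(e^{-2v})$.
\<close>

section \<open>Rational bound for \<open>arccot\<close> and the algebra of the supersolution\<close>

text \<open>In terms of \<open>w = 1 / z\<close> the bound is 3w/(3+w^2), a Pade approximant of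
  \<open>arctan w\<close> agreeing with it through order 4. The derivative of the difference is
  therefore a positive multiple of u^4.\<close>

lemma arccot_gt:
  assumes "z > 0"
  shows "3 * z / (3 * z\<^sup>2 + 1) < arccot z"
proof -
  define w where "w = 1 / z"
  have w: "w > 0" using assms by (simp add: w_def)
  define f where "f = (\<lambda>u::real. arctan u - 3 * u / (3 + u\<^sup>2))"
  have "f 0 < f w"
  proof (rule DERIV_pos_imp_increasing_open[OF w])
    fix u :: real assume "0 < u" "u < w"
    have nz: "3 + u\<^sup>2 > 0" "1 + u\<^sup>2 > 0" by (simp_all add: add_pos_nonneg)
    have "(f has_real_derivative 1 / (1 + u\<^sup>2) - (9 - 3 * u\<^sup>2) / (3 + u\<^sup>2)\<^sup>2) (at u)"
      unfolding f_def using nz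
      by (auto intro!: derivative_eq_intros simp: field_simps power2_eq_square)
    moreover have "1 / (1 + u\<^sup>2) - (9 - 3 * u\<^sup>2) / (3 + u\<^sup>2)\<^sup>2
        = 4 * u ^ 4 / ((1 + u\<^sup>2) * (3 + u\<^sup>2)\<^sup>2)"
      using nz by (simp add: divide_simps) algebra
    ultimately show "\<exists>d. (f has_real_derivative d) (at u) \<and> 0 < d"
      using nz \<open>0 < u\<close> by auto
  next
    show "continuous_on {0..w} f" unfolding f_def
      by (intro continuous_intros) (simp add: add_nonneg_eq_0_iff)
  qed
  moreover have "arccot z = arctan w"
    using arctan_inverse[of z] assms by (simp add: arccot_def w_def sgn_if inverse_eq_divide)
  moreover have "3 * w / (3 + w\<^sup>2) = 3 * z / (3 * z\<^sup>2 + 1)"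
    using assms by (simp add: w_def divide_simps power2_eq_square)
  ultimately show ?thesis by (simp add: f_def)
qed

text \<open>This is $zq - q' \ge 1/r$ after clearing denominators.\<close>
lemma supersolution_inequality:
  fixes z s :: real
  assumes z: "z \<ge> 7 / 5" and s: "s \<ge> 0" and r: "r = sqrt (1 + s\<^sup>2)"
  shows "(1 / (3 * z) + s / (2 * r)) * (z * r + 1 / (3 * z) + s / (2 * r)) \<le> z * s + 1 / (2 * r\<^sup>2)"
proof -
  define a where "a = 1 / (3 * z)"
  \<comment> \<open>If s is the tangent of an angle, then r is its secant and c its sine. This
    trades the root for r^2 (1 - c^2) = 1 and leaves c in [0, 1).\<close>
  define c where "c = s / r"
  have r1: "r \<ge> 1" using s by (simp add: r)
  have r2: "r\<^sup>2 = 1 + s\<^sup>2" by (simp add: r)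
  have sc: "s = c * r" using r1 by (simp add: c_def)
  have c0: "c \<ge> 0" using s r1 by (simp add: c_def)
  have rc: "r\<^sup>2 * (1 - c\<^sup>2) = 1" using r2 unfolding sc by (simp add: algebra_simps power2_eq_square)
  have c1: "c < 1"
  proof (rule ccontr)
    assume "\<not> c < 1"
    then have "c\<^sup>2 \<ge> 1" by simp
    then have "r\<^sup>2 * (1 - c\<^sup>2) \<le> 0" by (simp add: mult_nonneg_nonpos)
    with rc show False by simp
  qed
  have ir: "1 / r\<^sup>2 = 1 - c\<^sup>2" using rc r1 by (simp add: field_simps)
  have az: "a * z = 1 / 3" using z by (simp add: a_def)
  have a0: "a \<ge> 0" using z by (simp add: a_def)
  have a1: "a \<le> 5 / 21" using z by (simp add: a_def field_simps)
  have aa: "a\<^sup>2 \<le> (5 / 21)\<^sup>2" using a0 a1 by (intro power_mono) auto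
  have ac: "a * c \<le> 5 / 21 * c" using a1 c0 by (intro mult_right_mono)
  \<comment> \<open>This is the difference of the two sides of the claim with \<open>z\<close> and
    \<open>a\<close> replaced by their extreme values 7/5 and 5/21, which can only lower it. The
    sign of the coefficient of \<open>r\<close> decides whether \<open>r\<close> must be bounded
    from below or from above.\<close>
  have "0 \<le> (7 / 10 * c - 1 / 3) * r + 1 / 2 - (5 / 21)\<^sup>2 - 5 / 21 * c - 3 / 4 * c\<^sup>2"
  proof (cases "7 / 10 * c \<ge> 1 / 3")
    case True
    \<comment> \<open>Since r = (1 - c^2)^(-1/2), its Taylor polynomial 1 + c^2/2 is a lower
      bound.\<close>
    have "(1 + c\<^sup>2 / 2)\<^sup>2 * (1 - c\<^sup>2) \<le> 1"
    proof -
      have "1 - (1 + c\<^sup>2 / 2)\<^sup>2 * (1 - c\<^sup>2) = 3 / 4 * c ^ 4 + c ^ 6 / 4"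
        by (simp add: field_simps power2_eq_square eval_nat_numeral)
      moreover have "0 \<le> 3 / 4 * c ^ 4 + c ^ 6 / 4" using c0 by simp
      ultimately show ?thesis by linarith
    qed
    then have "(1 + c\<^sup>2 / 2)\<^sup>2 * (1 - c\<^sup>2) \<le> r\<^sup>2 * (1 - c\<^sup>2)" using rc by simp
    moreover have "1 - c\<^sup>2 > 0" using c0 c1 by (simp add: power_less_one_iff abs_square_less_1)
    ultimately have "(1 + c\<^sup>2 / 2)\<^sup>2 \<le> r\<^sup>2" by simp
    then have "1 + c\<^sup>2 / 2 \<le> r" 
      by (rule power2_le_imp_le) (use r1 in simp)
    then have "(7 / 10 * c - 1 / 3) * (1 + c\<^sup>2 / 2) \<le> (7 / 10 * c - 1 / 3) * r"
      using True by (intro mult_left_mono) auto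
    moreover have "0 \<le> (7 / 10 * c - 1 / 3) * (1 + c\<^sup>2 / 2) + 1 / 2 - (5 / 21)\<^sup>2 - 5 / 21 * c - 3 / 4 * c\<^sup>2"
    proof -
      \<comment> \<open>The expression is tight near c = 1, where only 23/4410 is left, so it is
        expanded around that endpoint.\<close>
      define d where "d = 1 - c"
      have d: "0 \<le> d" "d \<le> 1" "c = 1 - d" using c0 c1 by (auto simp: d_def)
      have "d\<^sup>2 \<le> d" "d ^ 3 \<le> d\<^sup>2" "d ^ 3 \<ge> 0"
        using d power_decreasing[of 1 2 d] power_decreasing[of 2 3 d] by auto
      moreover have "(7 / 10 * c - 1 / 3) * (1 + c\<^sup>2 / 2) + 1 / 2 - (5 / 21)\<^sup>2 - 5 / 21 * c - 3 / 4 * c\<^sup>2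
          = 23 / 4410 + 9 / 28 * d + 2 / 15 * d\<^sup>2 - 7 / 20 * d ^ 3"
        unfolding d(3) by (simp add: field_simps power2_eq_square power3_eq_cube)
      ultimately show ?thesis using d by linarith
    qed
    ultimately show ?thesis by linarith
  next
    case False
    have c2: "c\<^sup>2 \<le> 1 / 4" using False c0 power_mono[of c "1/2" 2] by (simp add: power2_eq_square)
    \<comment> \<open>For c at most 1/2 the polynomial 1 + c^2 is an upper bound for
      \<open>r\<close>.\<close>
    have "1 \<le> (1 + c\<^sup>2)\<^sup>2 * (1 - c\<^sup>2)"
    proof -
      have "(1 + c\<^sup>2)\<^sup>2 * (1 - c\<^sup>2) - 1 = c\<^sup>2 * (1 - c\<^sup>2 - c\<^sup>2 * c\<^sup>2)"
        by (simp add: algebra_simps power2_eq_square)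
      moreover have "c\<^sup>2 * c\<^sup>2 \<le> 1 / 4 * (1/4)" using c2 by (intro mult_mono) auto
      moreover from this have "0 \<le> c\<^sup>2 * (1 - c\<^sup>2 - c\<^sup>2 * c\<^sup>2)"
        using c2 by (intro mult_nonneg_nonneg) auto
      ultimately show ?thesis by linarith
    qed
    then have "r\<^sup>2 * (1 - c\<^sup>2) \<le> (1 + c\<^sup>2)\<^sup>2 * (1 - c\<^sup>2)" using rc by simp
    then have "r\<^sup>2 \<le> (1 + c\<^sup>2)\<^sup>2" using c2 by simp
    then have "r \<le> 1 + c\<^sup>2" by (rule power2_le_imp_le) simp
    then have "(1 / 3 - 7 / 10 * c) * r \<le> (1 / 3 - 7 / 10 * c) * (1 + c\<^sup>2)"
      using False by (intro mult_left_mono) auto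
    moreover have "0 \<le> 1 / 2 - (5 / 21)\<^sup>2 - 5 / 21 * c - 3 / 4 * c\<^sup>2 - (1 / 3 - 7 / 10 * c) * (1 + c\<^sup>2)"
    proof -
      have "1 / 2 - (5 / 21)\<^sup>2 - 5 / 21 * c - 3 / 4 * c\<^sup>2 - (1 / 3 - 7 / 10 * c) * (1 + c\<^sup>2)
        = 97 / 882 + c * (97 / 210 - 13 / 12 * c) + 7 / 10 * c ^ 3" 
        by (simp add: field_simps power2_eq_square power3_eq_cube)
      \<comment> \<open>Here c < 10/21, where the bracket exceeds -17/315; the constant -107/1980
        lies slightly below that.\<close>
      moreover have "c * (- 107 / 1980) \<le> c * (97 / 210 - 13 / 12 * c)"
        using False c0 by (intro mult_left_mono) auto
      moreover have "c ^ 3 \<ge> 0" using c0 by simp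
      ultimately show ?thesis using c0 False by linarith
    qed
    ultimately show ?thesis by (simp add: algebra_simps)
  qed
  also have "\<dots> \<le> (z * c / 2 - 1 / 3) * r + 1 / 2 - a\<^sup>2 - a * c - 3 / 4 * c\<^sup>2"
  proof -
    have "7 / 10 * c * r \<le> z / 2 * c * r"
      using z c0 r1 by (intro mult_right_mono) auto
    with aa ac show ?thesis by (simp add: algebra_simps)
  qed
  \<comment> \<open>The choice a = 1/(3z) makes the cross term a z r equal to r/3, free of
    \<open>z\<close>.\<close>
  also have "\<dots> = z * s + 1 / (2 * r\<^sup>2) - (a + c / 2) * (z * r + a + c / 2)"
  proof -
    have e1: "1 / (2 * r\<^sup>2) = (1 - c\<^sup>2) / 2" using ir by simp
    have e2: "a * (z * r) = r / 3" using az by (simp flip: mult.assoc)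
    have e3: "(a + c / 2) * (z * r + a + c / 2)
        = a * (z * r) + a\<^sup>2 + a * c + z * s / 2 + c\<^sup>2 / 4"
      by (simp add: sc algebra_simps power2_eq_square)
    have e4: "(z * c / 2 - 1 / 3) * r = z * s / 2 - r / 3"
      by (simp add: sc algebra_simps)
    show ?thesis unfolding e1 e3 e4 e2 by (simp add: field_simps)
  qed
  finally show ?thesis by (simp add: a_def c_def mult.commute[of r 2])
qed

section \<open>Elementary estimates and the Dirichlet kernel\<close>

lemma arctan_le_self:
  fixes x :: real
  assumes "x \<ge> 0"
  shows "arctan x \<le> x"
proof -
  have "0 - arctan 0 \<le> x - arctan x"
  proof (rule DERIV_nonneg_imp_nondecreasing[OF assms])
    fix u :: real
    have "((\<lambda>u. u - arctan u) has_real_derivative 1 - 1 / (1 + u\<^sup>2)) (at u)"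
      by (auto intro!: derivative_eq_intros simp: divide_inverse)
    moreover have "1 / (1 + u\<^sup>2) \<le> 1" by (simp add: divide_le_eq add_pos_nonneg)
    ultimately show "\<exists>d. ((\<lambda>u. u - arctan u) has_real_derivative d) (at u) \<and> 0 \<le> d"
      by (intro exI conjI) auto
  qed
  then show ?thesis by simp
qed

lemma sin_ge_cubic:
  fixes u :: real
  assumes "u \<ge> 0"
  shows "u - u ^ 3 / 6 \<le> sin u"
proof -
  have "\<bar>sin u - u\<bar> \<le> u ^ 3 / 6"
    using Maclaurin_sin_bound[of u 3] assms
    by (simp add: numeral_3_eq_3 sin_coeff_def)
  then show ?thesis by linarith
qed

text \<open>The factor 23/24 is 1 - u^2/6 at u = 1/2, from the cubic bound.\<close>

lemma sin_ge_linear: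
  fixes u :: real
  assumes "0 \<le> u" "u \<le> 1 / 2"
  shows "23 / 24 * u \<le> sin u"
proof -
  have "u\<^sup>2 \<le> (1 / 2)\<^sup>2" using assms by (intro power_mono) auto
  then have "u * (23 / 24) \<le> u * (1 - u\<^sup>2 / 6)"
    using assms by (intro mult_left_mono) (auto simp: power2_eq_square)
  also have "\<dots> \<le> sin u"
    using sin_ge_cubic[of u] assms by (simp add: algebra_simps power3_eq_cube power2_eq_square)
  finally show ?thesis by simp
qed

text \<open>Product-to-sum makes the terms telescope. The identity yields R' = -sin(Ny)/sin
  y.\<close>

lemma dirichlet_kernel:
  fixes y :: real
  shows "sin y * (1 + 2 * (\<Sum>k=1..n. cos (2 * real k * y))) = sin ((2 * real n + 1) * y)"
proof (induction n)
  case (Suc n)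
  define w where "w = (2 * real n + 2) * y"
  have "2 * (sin y * cos w) = sin (w + y) - sin (w - y)"
    by (simp add: sin_add sin_diff)
  then have "2 * (sin y * cos (2 * real (Suc n) * y)) = sin ((2 * real n + 3) * y) - sin ((2 * real n + 1) * y)"
    by (simp add: w_def algebra_simps)
  with Suc show ?case by (simp add: algebra_simps)
qed simp

text \<open>The left side is the derivative of arctan(N sin u), the right side is -R'. With p = Nu,
  the bounds cos u <= 1, sin u <= u, the cubic bound for sin p and (23/24)^2 > 9/10 reduce the claim
  to 1 < (1 - p^2/6)(1 + 9p^2/10).\<close>

lemma rational_kernel_lt:
  fixes u N :: real
  assumes u: "0 < u" "u \<le> 1 / 2" and N: "0 < N" "N * u \<le> 3 / 2"
  shows "N * cos u / (1 + (N * sin u)\<^sup>2) < sin (N * u) / sin u"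
proof -
  define p where "p = N * u"
  have p: "0 < p" "p \<le> 3 / 2" using u N by (auto simp: p_def)
  have p2: "p\<^sup>2 \<le> (3 / 2)\<^sup>2" using p by (intro power_mono) auto
  have su: "23 / 24 * u \<le> sin u" using u by (intro sin_ge_linear) auto
  then have su0: "sin u > 0" using u by linarith
  have "p * (23 / 24) \<le> N * sin u"
    using su N mult_left_mono[of "23 / 24 * u" "sin u" N] by (simp add: p_def mult_ac)
  then have "(p * (23 / 24))\<^sup>2 \<le> (N * sin u)\<^sup>2" using p by (intro power_mono) auto
  then have "529 / 576 * p\<^sup>2 \<le> (N * sin u)\<^sup>2"
    unfolding power_mult_distrib[of p "23 / 24"] by (simp add: power_divide)
  then have ns: "9 / 10 * p\<^sup>2 \<le> (N * sin u)\<^sup>2"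
    using zero_le_power2[of p] by linarith
  have "0 \<le> cos u" using u pi_ge_two by (intro cos_ge_zero) auto
  then have "N * cos u * sin u \<le> N * 1 * u"
    using u N su0 sin_x_le_x[of u] by (intro mult_mono) auto
  also have "\<dots> = p * 1" by (simp add: p_def)
  also have "\<dots> < p * ((1 - p\<^sup>2 / 6) * (1 + 9 / 10 * p\<^sup>2))"
  proof -
    have "p\<^sup>2 * (11 / 15 - 3 / 20 * p\<^sup>2) > 0" using p p2 by (intro mult_pos_pos) (auto simp: power2_eq_square)
    then have "1 < (1 - p\<^sup>2 / 6) * (1 + 9 / 10 * p\<^sup>2)" by (simp add: algebra_simps)
    then show ?thesis using p by simp
  qed
  also have "\<dots> = (p - p ^ 3 / 6) * (1 + 9 / 10 * p\<^sup>2)" by (simp add: algebra_simps power3_eq_cube power2_eq_square)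
  also have "\<dots> \<le> sin p * (1 + (N * sin u)\<^sup>2)"
  proof (rule mult_mono)
    show "p - p ^ 3 / 6 \<le> sin p" using sin_ge_cubic p by simp
    show "0 \<le> sin p" using p pi_ge_two by (intro sin_ge_zero) auto
  qed (use ns in auto)
  finally have "N * cos u * sin u < sin p * (1 + (N * sin u)\<^sup>2)" .
  moreover have "1 + (N * sin u)\<^sup>2 > 0" by (simp add: add_pos_nonneg)
  ultimately show ?thesis using su0 by (simp add: p_def divide_simps mult.commute)
qed

section \<open>Abel-weighted sine sums\<close>

text \<open>This is the imaginary part of a finite geometric sum with ratio t e^(ix), cleared of the
  denominator |1 - t e^(ix)|^2.\<close>

lemma sin_sum_kernel:
  fixes t x :: real
  shows "(\<Sum>k=1..n. t ^ (k - 1) * sin (real k * x)) * (1 - 2 * t * cos x + t\<^sup>2)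
    = sin x - t ^ n * (sin (real (Suc n) * x) - t * sin (real n * x))"
proof (induction n)
  case (Suc n)
  define w where "w = real (Suc n) * x"
  have "sin (w - x) + sin (w + x) = 2 * cos x * sin w"
    by (simp add: sin_add sin_diff)
  then have "sin (real n * x) + sin (real (Suc (Suc n)) * x) = 2 * cos x * sin (real (Suc n) * x)"
    by (simp add: w_def algebra_simps)
  then have *: "sin (real (Suc (Suc n)) * x) = 2 * cos x * sin (real (Suc n) * x) - sin (real n * x)" by simp
  show ?case using Suc unfolding * by (simp add: algebra_simps power2_eq_square)
qed simp

text \<open>The arctangent is -Im log(1 - t e^(ix)), the closed form of the full series of t^k
  sin(kx)/k for 0 <= t < 1. The differentiated function is thus H, written without an infinite sum
  and hence available at t = 1 too.\<close>

lemma has_real_derivative_abel_remainder: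
  fixes t x :: real
  assumes "t * cos x < 1"
  shows "((\<lambda>t. arctan (t * sin x / (1 - t * cos x)) - (\<Sum>k=1..n. t ^ k * sin (real k * x) / real k))
    has_real_derivative t ^ n * (sin (real (Suc n) * x) - t * sin (real n * x)) / (1 - 2 * t * cos x + t\<^sup>2)) (at t)"
proof -
  define D where "D = 1 - 2 * t * cos x + t\<^sup>2"
  have D: "D = (1 - t * cos x)\<^sup>2 + (t * sin x)\<^sup>2"
    using sin_cos_squared_add[of x] unfolding D_def by algebra
  have nz: "1 - t * cos x > 0" using assms by simp
  then have D0: "D > 0" unfolding D by (simp add: add_pos_nonneg)
  have "((\<lambda>t. t * sin x / (1 - t * cos x)) has_real_derivative sin x / (1 - t * cos x)\<^sup>2) (at t)"
    using nz by (auto intro!: derivative_eq_intros simp: field_simps power2_eq_square)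
  from DERIV_chain2[OF DERIV_arctan this]
  have d1: "((\<lambda>t. arctan (t * sin x / (1 - t * cos x))) has_real_derivative sin x / D) (at t)"
    using nz unfolding D by (simp add: power_divide divide_simps split: if_splits)
  have d2: "((\<lambda>t. \<Sum>k=1..n. t ^ k * sin (real k * x) / real k) has_real_derivative
     (\<Sum>k=1..n. t ^ (k - 1) * sin (real k * x))) (at t)"
    by (auto intro!: derivative_eq_intros sum.cong)
  have "sin x / D - (\<Sum>k=1..n. t ^ (k - 1) * sin (real k * x))
      = t ^ n * (sin (real (Suc n) * x) - t * sin (real n * x)) / D"
    using sin_sum_kernel[where n = n and t = t and x = x] D0 by (simp add: D_def field_simps)
  with DERIV_diff[OF d1 d2] show ?thesis unfolding D_def by (simp only:)
qed

text \<open>The left side is |Im(e^(inx) (e^(ix) - t))| and the right side is the modulus of the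
  same number; the square in the proof is that of its real part.\<close>

lemma abs_sin_kernel_le:
  fixes t x :: real
  shows "\<bar>sin (real (Suc n) * x) - t * sin (real n * x)\<bar> \<le> sqrt (1 - 2 * t * cos x + t\<^sup>2)"
proof -
  define w where "w = real n * x"
  have *: "sin (real (Suc n) * x) = sin w * cos x + cos w * sin x"
    by (simp add: w_def algebra_simps sin_add)
  have "1 - 2 * t * cos x + t\<^sup>2 - (sin (real (Suc n) * x) - t * sin w)\<^sup>2
      = (cos w * (cos x - t) - sin w * sin x)\<^sup>2"
    using sin_cos_squared_add[of x] sin_cos_squared_add[of w] unfolding * by algebra
  moreover have "0 \<le> (cos w * (cos x - t) - sin w * sin x)\<^sup>2" by (rule zero_le_power2)
  ultimately have "(sin (real (Suc n) * x) - t * sin w)\<^sup>2 \<le> 1 - 2 * t * cos x + t\<^sup>2"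
    by linarith
  then have "sqrt ((sin (real (Suc n) * x) - t * sin w)\<^sup>2) \<le> sqrt (1 - 2 * t * cos x + t\<^sup>2)"
    by (rule real_sqrt_le_mono)
  then show ?thesis by (simp only: w_def real_sqrt_abs)
qed

section \<open>Range z >= 7/5: majorant and Abel limit\<close>

text \<open>With s = sinh v / c and N = z/c, the derivative of e^(-Nv) q(s) is -(e^(-Nv)/c)(z q - q'
  cosh v). Since q' <= 0 and cosh v >= 1, the bound z q - q' >= 1/r suffices, and c r is the root in
  the claim.\<close>

lemma exp_weighted_supersolution:
  fixes N c v z :: real
  assumes c: "c > 0" and z: "z = N * c" "z \<ge> 7 / 5" and v: "v \<ge> 0"
  defines "Q \<equiv> \<lambda>v. exp (- N * v) /
    (z * sqrt (1 + (sinh v / c)\<^sup>2) + 1 / (3 * z) + sinh v / c / (2 * sqrt (1 + (sinh v / c)\<^sup>2)))"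
  shows "\<exists>d. (Q has_real_derivative d) (at v) \<and> d \<le> - exp (- N * v) / sqrt (c\<^sup>2 + (sinh v)\<^sup>2)"
proof -
  define s where "s = sinh v / c"
  define r where "r = sqrt (1 + s\<^sup>2)"
  define g where "g = 1 / (3 * z) + s / (2 * r)"
  define D where "D = z * r + g"
  define e where "e = exp (- N * v)"
  define q' where "q' = - (z * s / r + 1 / (2 * r ^ 3)) / D\<^sup>2"
  have s0: "s \<ge> 0" using c v by (simp add: s_def)
  have rpos: "r > 0" unfolding r_def by (simp add: add_pos_nonneg)
  have g0: "g \<ge> 0" using s0 rpos z by (simp add: g_def)
  have D0: "D > 0" using g0 z rpos by (simp add: D_def add_pos_nonneg)
  have r2: "r\<^sup>2 = 1 + s\<^sup>2" by (simp add: r_def)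
  have ds: "((\<lambda>v. sinh v / c) has_real_derivative cosh v / c) (at v)"
    using c by (auto intro!: derivative_eq_intros)
  have dr: "((\<lambda>s. sqrt (1 + s\<^sup>2)) has_real_derivative s / r) (at s)"
  proof -
    have "1 + s\<^sup>2 > 0" by (simp add: add_pos_nonneg)
    moreover have "((\<lambda>s. 1 + s\<^sup>2) has_real_derivative 2 * s) (at s)"
      by (auto intro!: derivative_eq_intros)
    ultimately have "((\<lambda>s. sqrt (1 + s\<^sup>2)) has_real_derivative inverse r / 2 * (2 * s)) (at s)"
      unfolding r_def
      by (intro DERIV_chain2[where f = sqrt and g = "\<lambda>s. 1 + s\<^sup>2"] DERIV_real_sqrt)
    moreover have "inverse r / 2 * (2 * s) = s / r" by (simp add: field_simps)
    ultimately show ?thesis by (simp only:)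
  qed
  have dg: "((\<lambda>s. s / (2 * sqrt (1 + s\<^sup>2))) has_real_derivative 1 / (2 * r ^ 3)) (at s)"
  proof -
    have "((\<lambda>s. s / (2 * sqrt (1 + s\<^sup>2))) has_real_derivative
        (1 * (2 * r) - s * (2 * (s / r))) / (2 * r * (2 * r))) (at s)"
      using rpos unfolding r_def
      by (intro DERIV_divide DERIV_cmult DERIV_ident dr[unfolded r_def]) auto
    moreover have "(1 * (2 * r) - s * (2 * (s / r))) / (2 * r * (2 * r)) = 2 * (r\<^sup>2 - s\<^sup>2) / (4 * r ^ 3)"
      using rpos by (simp add: field_simps power2_eq_square power3_eq_cube)
    ultimately show ?thesis by (simp add: r2)
  qed
  have dq: "((\<lambda>s. 1 / (z * sqrt (1 + s\<^sup>2) + 1 / (3 * z) + s / (2 * sqrt (1 + s\<^sup>2)))) has_real_derivative q') (at s)"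
  proof -
    define G where "G = (\<lambda>s. z * sqrt (1 + s\<^sup>2) + 1 / (3 * z) + s / (2 * sqrt (1 + s\<^sup>2)))"
    have "(G has_real_derivative z * (s / r) + 0 + 1 / (2 * r ^ 3)) (at s)"
      unfolding G_def by (intro DERIV_add DERIV_cmult dr dg DERIV_const)
    moreover have GD: "G s = D"
      by (simp add: G_def D_def g_def r_def)
    ultimately have "((\<lambda>s. 1 / G s) has_real_derivative
        (0 * G s - 1 * (z * (s / r) + 0 + 1 / (2 * r ^ 3))) / (G s * G s)) (at s)"
      using D0 by (intro DERIV_divide DERIV_const) auto
    moreover have "(0 * G s - 1 * (z * (s / r) + 0 + 1 / (2 * r ^ 3))) / (G s * G s) = q'"
      unfolding q'_def GD by (simp add: power2_eq_square)
    ultimately show ?thesis unfolding G_def by (simp only:)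
  qed
  have de: "((\<lambda>v. exp (- N * v)) has_real_derivative - N * e) (at v)"
    unfolding e_def by (auto intro!: derivative_eq_intros)
  define q where "q = (\<lambda>s. 1 / (z * sqrt (1 + s\<^sup>2) + 1 / (3 * z) + s / (2 * sqrt (1 + s\<^sup>2))))"
  have qs: "q (sinh v / c) = 1 / D"
    unfolding s_def[symmetric] by (simp add: q_def D_def g_def r_def)
  have "((\<lambda>v. q (sinh v / c)) has_real_derivative q' * (cosh v / c)) (at v)"
    using dq ds unfolding s_def q_def[symmetric] by (rule DERIV_chain2)
  from DERIV_mult[OF de this]
  have dQ: "(Q has_real_derivative - N * e * (1 / D) + q' * (cosh v / c) * e) (at v)"
    unfolding qs e_def[symmetric] by (simp only: Q_def q_def times_divide_eq_right mult_1_right)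
  have "1 / r \<le> z / D - q'"
  proof -
    \<comment> \<open>Because D = z r + g, the product g D is D^2 - z r D, so the algebraic
      inequality is the wanted one multiplied by r D^2.\<close>
    have "g * D \<le> z * s + 1 / (2 * r\<^sup>2)"
      using supersolution_inequality[OF z(2) s0, of r] by (simp add: r_def g_def D_def add.assoc)
    then have "D\<^sup>2 \<le> z * r * D + (z * s + 1 / (2 * r\<^sup>2))"
      by (simp add: D_def algebra_simps power2_eq_square)
    also have "\<dots> = (z / D - q') * r * D\<^sup>2"
      using rpos D0 by (simp add: q'_def field_simps power2_eq_square power3_eq_cube)
    finally have "1 * D\<^sup>2 \<le> (z / D - q') * r * D\<^sup>2" by simp
    then have "1 \<le> (z / D - q') * r" by (rule mult_right_le_imp_le) (use D0 in simp)
    then show ?thesis using rpos by (simp add: divide_le_eq)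
  qed
  moreover have "z * s / r + 1 / (2 * r ^ 3) \<ge> 0" using s0 rpos z(2) by simp
  then have "q' \<le> 0" unfolding q'_def by (intro divide_nonpos_nonneg) simp_all
  then have "q' * cosh v \<le> q' * 1" by (intro mult_left_mono_neg cosh_real_ge_1)
  ultimately have "1 / r \<le> z / D - q' * cosh v" by linarith
  then have "e / c * (1 / r) \<le> e / c * (z / D - q' * cosh v)"
    using c by (intro mult_left_mono) (auto simp: e_def)
  also have "\<dots> = - (- N * e * (1 / D) + q' * (cosh v / c) * e)"
    using c by (simp add: z(1) field_simps)
  also have "e / c * (1 / r) = e / sqrt (c\<^sup>2 + (sinh v)\<^sup>2)"
  proof -
    have "c\<^sup>2 * (1 + s\<^sup>2) = c\<^sup>2 + (sinh v)\<^sup>2" using c by (simp add: s_def field_simps)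
    moreover have "c * r = sqrt (c\<^sup>2 * (1 + s\<^sup>2))" using c by (simp add: r_def real_sqrt_mult)
    ultimately show ?thesis by simp
  qed
  finally have "e / sqrt (c\<^sup>2 + (sinh v)\<^sup>2) \<le> - (- N * e * (1 / D) + q' * (cosh v / c) * e)" .
  then have "- N * e * (1 / D) + q' * (cosh v / c) * e \<le> - e / sqrt (c\<^sup>2 + (sinh v)\<^sup>2)"
    by simp
  then show ?thesis using dQ unfolding e_def by blast
qed

lemma remainder_le_far:
  fixes x :: real
  assumes x: "0 < x" "x < pi" and z: "z = (2 * real n + 1) * sin (x / 2)" "z \<ge> 7 / 5"
  shows "\<bar>(pi - x) / 2 - (\<Sum>k=1..n. sin (real k * x) / real k)\<bar> \<le> 3 * z / (3 * z\<^sup>2 + 1)"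
proof -
  define c where "c = sin (x / 2)"
  define N where "N = 2 * real n + 1"
  define H where "H = (\<lambda>t. arctan (t * sin x / (1 - t * cos x)) - (\<Sum>k=1..n. t ^ k * sin (real k * x) / real k))"
  define Q where "Q = (\<lambda>v. exp (- N * v) /
    (z * sqrt (1 + (sinh v / c)\<^sup>2) + 1 / (3 * z) + sinh v / c / (2 * sqrt (1 + (sinh v / c)\<^sup>2))))"
  have c: "c > 0" using x by (simp add: c_def sin_gt_zero)
  have cosx: "cos x = 1 - 2 * c\<^sup>2" using cos_double_sin[of "x / 2"] by (simp add: c_def)
  have cos1: "cos x < 1" using c by (simp add: cosx)
  \<comment> \<open>This covers t = 1 as well, so H is differentiable up to that endpoint.\<close>
  have tc: "t * cos x < 1" if "0 \<le> t" "t \<le> 1" for t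
  proof -
    have "\<bar>t * cos x\<bar> \<le> 1 * \<bar>cos x\<bar>"
      unfolding abs_mult using that by (intro mult_right_mono) auto
    moreover have "\<bar>cos x\<bar> < 1"
      using cos1 cos_monotone_0_pi[of x pi] x by simp
    ultimately show ?thesis by linarith
  qed
  have dK: "\<exists>d. ((\<lambda>v. H (exp (- 2 * v))) has_real_derivative d) (at v) \<and>
      \<bar>d\<bar> \<le> exp (- N * v) / sqrt (c\<^sup>2 + (sinh v)\<^sup>2)" if v: "v \<ge> 0" for v
  proof -
    define t where "t = exp (- 2 * v)"
    have t: "0 < t" "t \<le> 1" using v by (auto simp: t_def)
    define S where "S = sin (real (Suc n) * x) - t * sin (real n * x)"
    define E where "E = 1 - 2 * t * cos x + t\<^sup>2"
    have "(H has_real_derivative t ^ n * S / E) (at t)"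
      unfolding H_def S_def E_def using t by (intro has_real_derivative_abel_remainder tc) auto
    moreover have "((\<lambda>v. exp (- 2 * v)) has_real_derivative - 2 * t) (at v)"
      unfolding t_def by (auto intro!: derivative_eq_intros)
    ultimately have "((\<lambda>v. H (exp (- 2 * v))) has_real_derivative t ^ n * S / E * (- 2 * t)) (at v)"
      unfolding t_def by (rule DERIV_chain2)
    moreover have "\<bar>t ^ n * S / E * (- 2 * t)\<bar> \<le> exp (- N * v) / sqrt (c\<^sup>2 + (sinh v)\<^sup>2)"
    proof -
      have w: "exp (- v) * exp (- v) = t" "exp v * exp v * t = 1" "exp (- v) * exp v = 1"
        by (simp_all add: t_def flip: exp_add)
      \<comment> \<open>With t = e^(-2v) the quadratic 1 - 2t cos x + t^2 becomes 4t(c^2 + sinh^2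
        v). The factor 2 sqrt t then cancels against dt/dv = -2t, which leaves t^(n+1) e^v =
        e^(-Nv).\<close>
      have "(2 * exp (- v))\<^sup>2 * (c\<^sup>2 + (sinh v)\<^sup>2) = 4 * t * c\<^sup>2 + (exp (- v) * exp v - exp (- v) * exp (- v))\<^sup>2"
        using w(1) by (simp add: sinh_field_def field_simps power2_eq_square)
      also have "\<dots> = E" unfolding w E_def cosx by (simp add: algebra_simps power2_eq_square)
      finally have E: "E = (2 * exp (- v))\<^sup>2 * (c\<^sup>2 + (sinh v)\<^sup>2)" by (rule sym)
      have cs: "c\<^sup>2 + (sinh v)\<^sup>2 > 0" using c by (simp add: add_pos_nonneg)
      have E0: "E > 0" unfolding E using cs by simp
      have sE: "sqrt E = 2 * exp (- v) * sqrt (c\<^sup>2 + (sinh v)\<^sup>2)"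
        unfolding E by (simp only: real_sqrt_mult real_sqrt_abs) simp
      have "\<bar>t ^ n * S / E * (- 2 * t)\<bar> = 2 * t ^ Suc n * \<bar>S\<bar> / E"
        using t E0 by (simp only: abs_mult abs_divide) (simp add: mult_ac)
      also have "\<dots> \<le> 2 * t ^ Suc n * sqrt E / E"
        using t E0 abs_sin_kernel_le[of n x t] by (intro divide_right_mono mult_left_mono) (simp_all only: S_def E_def, simp_all)
      also have "\<dots> = 2 * t ^ Suc n / sqrt E"
        using E0 real_sqrt_mult_self[of E] by (simp add: field_simps)
      also have "\<dots> = t ^ Suc n * exp v / sqrt (c\<^sup>2 + (sinh v)\<^sup>2)"
        unfolding sE by (simp add: exp_minus field_simps)
      also have "t ^ Suc n * exp v = exp (- N * v)"
        unfolding t_def N_def by (simp flip: exp_of_nat_mult exp_add add: algebra_simps)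
      finally show ?thesis .
    qed
    ultimately show ?thesis by blast
  qed
  have dQ: "\<exists>d. (Q has_real_derivative d) (at v) \<and> d \<le> - exp (- N * v) / sqrt (c\<^sup>2 + (sinh v)\<^sup>2)"
    if "v \<ge> 0" for v
    unfolding Q_def using exp_weighted_supersolution[OF c, of z N v] that z by (simp add: N_def c_def)
  have bound: "\<bar>H 1 - H (exp (- 2 * v))\<bar> \<le> 3 * z / (3 * z\<^sup>2 + 1)" if v: "v \<ge> 0" for v
  proof -
    \<comment> \<open>The values 1 and -1 of \<open>\<sigma>\<close> give the two halves of the
      absolute value bound.\<close>
    have mono: "Q v + \<sigma> * H (exp (- 2 * v)) \<le> Q 0 + \<sigma> * H (exp (- 2 * 0))" if "\<bar>\<sigma>\<bar> = 1" for \<sigma>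
    proof (rule DERIV_nonpos_imp_nonincreasing[OF v])
      fix u :: real assume "0 \<le> u"
      from dK[OF this] dQ[OF this] obtain d d' where
        d: "((\<lambda>v. H (exp (- 2 * v))) has_real_derivative d) (at u)"
          "\<bar>d\<bar> \<le> exp (- N * u) / sqrt (c\<^sup>2 + (sinh u)\<^sup>2)"
        and d': "(Q has_real_derivative d') (at u)" "d' \<le> - exp (- N * u) / sqrt (c\<^sup>2 + (sinh u)\<^sup>2)"
        by blast
      have "((\<lambda>v. Q v + \<sigma> * H (exp (- 2 * v))) has_real_derivative d' + \<sigma> * d) (at u)"
        by (intro DERIV_add DERIV_cmult d d')
      moreover have "\<sigma> * d \<le> \<bar>d\<bar>" using that abs_le_D1[of "\<sigma> * d"] by (simp add: abs_mult)
      then have "d' + \<sigma> * d \<le> 0" using d(2) d'(2) by simp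
      ultimately show "\<exists>y. ((\<lambda>v. Q v + \<sigma> * H (exp (- 2 * v))) has_real_derivative y) (at u) \<and> y \<le> 0"
        by blast
    qed
    have "Q v \<ge> 0" using v c z by (simp add: Q_def)
    moreover have "Q 0 = 3 * z / (3 * z\<^sup>2 + 1)"
      using z by (simp add: Q_def divide_simps power2_eq_square)
    ultimately show ?thesis using mono[of 1] mono[of "-1"] by (simp add: abs_le_iff)
  qed
  \<comment> \<open>Letting v tend to infinity sends t to 0, where H vanishes; continuity of H there
    carries the uniform bound over to H(1) - H(0).\<close>
  have "isCont H 0"
    using has_real_derivative_abel_remainder[of 0 x n] unfolding H_def by (intro DERIV_isCont) auto
  moreover have "((\<lambda>v. exp (- 2 * v)) \<longlongrightarrow> (0::real)) at_top"
    by (intro filterlim_compose[OF exp_at_bot] filterlim_tendsto_neg_mult_at_bot[OF tendsto_const _ filterlim_ident]) simp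
  ultimately have "((\<lambda>v. H (exp (- 2 * v))) \<longlongrightarrow> H 0) at_top"
    by (rule isCont_tendsto_compose)
  then have "((\<lambda>v. \<bar>H 1 - H (exp (- 2 * v))\<bar>) \<longlongrightarrow> \<bar>H 1 - H 0\<bar>) at_top"
    by (intro tendsto_intros)
  moreover have "\<forall>\<^sub>F v in at_top. \<bar>H 1 - H (exp (- 2 * v))\<bar> \<le> 3 * z / (3 * z\<^sup>2 + 1)"
    using bound by (intro eventually_at_top_linorderI[of 0])
  ultimately have "\<bar>H 1 - H 0\<bar> \<le> 3 * z / (3 * z\<^sup>2 + 1)"
    by (intro tendsto_upperbound) auto
  moreover have "H 0 = 0" 
    unfolding H_def by (auto intro!: sum.neutral)
  moreover have "arctan (sin x / (1 - cos x)) = (pi - x) / 2"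
  proof (rule arctan_unique)
    have sx: "sin x = 2 * c * cos (x / 2)" using sin_double[of "x / 2"] by (simp add: c_def)
    show "tan ((pi - x) / 2) = sin x / (1 - cos x)"
      using c unfolding cosx sx
      by (simp add: tan_def diff_divide_distrib sin_diff cos_diff c_def power2_eq_square)
  qed (use x in auto)
  ultimately show ?thesis by (simp add: H_def)
qed

section \<open>Range z <= 7/5: comparison of derivatives\<close>

lemma remainder_lt_near:
  fixes y :: real
  assumes n: "n \<ge> 1" and y: "0 < y" "y < pi / 2" and z: "(2 * real n + 1) * sin y \<le> 7 / 5"
  shows "\<bar>pi / 2 - y - (\<Sum>k=1..n. sin (2 * real k * y) / real k)\<bar> < arccot ((2 * real n + 1) * sin y)"
proof -
  define N where "N = 2 * real n + 1"
  define R where "R = (\<lambda>u::real. pi / 2 - u - (\<Sum>k=1..n. sin (2 * real k * u) / real k))"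
  have N: "N \<ge> 3" using n by (simp add: N_def)
  have sy: "N * sin y \<le> 7 / 5" using z by (simp add: N_def)
  have siny: "0 \<le> sin y" using y by (simp add: sin_ge_zero)
  \<comment> \<open>Since N >= 3, sin y is at most 7/15 < 23/48 <= sin(1/2). So y <= 1/2, the linear
    sine bound applies, and Ny <= (24/23)(7/5) = 168/115 < 3/2.\<close>
  have "3 * sin y \<le> N * sin y" using N siny by (intro mult_right_mono) auto
  then have "sin y < 23 / 48" using sy by linarith
  also have "\<dots> \<le> sin (1 / 2)" using sin_ge_cubic[of "1 / 2"] by (simp add: power3_eq_cube)
  finally have y12: "y \<le> 1 / 2"
    using sin_mono_le_eq[of y "1 / 2"] y pi_ge_two by (auto simp: not_le)
  have "23 / 24 * y \<le> sin y" using y y12 by (intro sin_ge_linear) auto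
  then have "N * (23 / 24 * y) \<le> N * sin y" using N by (intro mult_left_mono) auto
  then have Ny: "N * y \<le> 168 / 115" using sy by simp
  have dR: "(R has_real_derivative - (sin (N * u) / sin u)) (at u)" if u: "0 < u" "u < pi" for u
  proof -
    have "(R has_real_derivative - 1 - 2 * (\<Sum>k=1..n. cos (2 * real k * u))) (at u)"
      unfolding R_def by (auto intro!: derivative_eq_intros sum.cong simp: sum_distrib_left)
    moreover have "- 1 - 2 * (\<Sum>k=1..n. cos (2 * real k * u)) = - (sin (N * u) / sin u)"
      using dirichlet_kernel[of u n] sin_gt_zero[OF u] by (simp add: N_def field_simps)
    ultimately show ?thesis by simp
  qed
  have contR: "continuous_on {0..y} R" unfolding R_def by (intro continuous_intros) auto
  have R0: "R 0 = pi / 2" by (simp add: R_def)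
  have "R 0 + arctan (N * sin 0) > R y + arctan (N * sin y)"
  \<comment> \<open>The rule for open intervals avoids u = 0, where the quotient sin(Nu)/sin u
    evaluates to 0 instead of its limit N.\<close>
  proof (rule DERIV_neg_imp_decreasing_open[OF y(1), where f = "\<lambda>u. R u + arctan (N * sin u)"])
    fix u assume u: "0 < u" "u < y"
    have "N * u \<le> N * y" using u N by (intro mult_left_mono) auto
    then have Nu: "N * u \<le> 3 / 2" using Ny by simp
    have "((\<lambda>u. arctan (N * sin u)) has_real_derivative N * cos u / (1 + (N * sin u)\<^sup>2)) (at u)"
      by (auto intro!: derivative_eq_intros simp: divide_inverse)
    then have "((\<lambda>u. R u + arctan (N * sin u)) has_real_derivative
        - (sin (N * u) / sin u) + N * cos u / (1 + (N * sin u)\<^sup>2)) (at u)"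
      using u y by (intro DERIV_add dR) auto
    then show "\<exists>d. ((\<lambda>u. R u + arctan (N * sin u)) has_real_derivative d) (at u) \<and> d < 0"
      using rational_kernel_lt[of u N] u y12 N Nu by (intro exI conjI) auto
  qed (intro continuous_intros contR)
  then have upper: "R y < arccot (N * sin y)" by (simp add: R0 arccot_def)
  \<comment> \<open>The kernel is at most N, so R(y) >= pi/2 - Ny.\<close>
  have "R 0 + N * 0 \<le> R y + N * y"
  proof (rule DERIV_nonneg_imp_increasing_open[where f = "\<lambda>u. R u + N * u"])
    fix u assume u: "0 < u" "u < y"
    have "sin (N * u) / sin u \<le> N"
    proof -
      have c1: "(\<Sum>k=1..n. cos (2 * real k * u)) \<le> (\<Sum>k=1..n. 1)" by (intro sum_mono) simp
      have "sin (N * u) / sin u = 1 + 2 * (\<Sum>k=1..n. cos (2 * real k * u))"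
        using dirichlet_kernel[of u n] sin_gt_zero[of u] u y by (simp add: N_def field_simps)
      with c1 show ?thesis by (simp add: N_def)
    qed
    moreover have "((\<lambda>u. R u + N * u) has_real_derivative - (sin (N * u) / sin u) + N * 1) (at u)"
      using u y by (intro DERIV_add dR DERIV_cmult DERIV_ident) auto
    ultimately show "\<exists>d. ((\<lambda>u. R u + N * u) has_real_derivative d) (at u) \<and> 0 \<le> d"
      by (intro exI conjI) auto
  qed (use y in \<open>auto intro!: continuous_intros contR\<close>)
  \<comment> \<open>At z = 1 the rational bound reads 3/4 < pi/4. The lower estimate then closes
    because Ny + 7/5 <= 168/115 + 7/5 < 3.\<close>
  moreover have "pi > 3" using arccot_gt[of 1] by (simp add: arccot_def arctan_one)
  moreover have "arctan (N * sin y) \<le> N * sin y" using N siny by (intro arctan_le_self) auto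
  ultimately have "- arccot (N * sin y) < R y"
    using R0 Ny sy unfolding arccot_def by linarith
  with upper show ?thesis unfolding R_def N_def by (simp add: abs_less_iff)
qed

section \<open>Combination of the two ranges\<close>

theorem theorem1:
  fixes n :: nat and x :: real
  assumes "n \<ge> 1" and "0 < x" and "x < pi"
  shows "\<bar>(\<Sum>k=1..n. sin (real k * x) / real k) - (pi - x) / 2\<bar>
           < arccot ((2 * real n + 1) * sin (x / 2))"
\<comment> \<open>The threshold 7/5 is small enough to keep Ny below 3/2 in the first case and large
  enough for the supersolution inequality in the second.\<close>
proof (cases "(2 * real n + 1) * sin (x / 2) \<le> 7 / 5")
  case True
  have "(\<Sum>k=1..n. sin (2 * real k * (x / 2)) / real k) = (\<Sum>k=1..n. sin (real k * x) / real k)"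
    by (intro sum.cong) auto
  then show ?thesis
    using remainder_lt_near[of n "x / 2"] assms True
    by (simp add: diff_divide_distrib abs_minus_commute)
next
  case False
  define z where "z = (2 * real n + 1) * sin (x / 2)"
  have "z \<ge> 7 / 5" using False by (simp add: z_def)
  then have "\<bar>(pi - x) / 2 - (\<Sum>k=1..n. sin (real k * x) / real k)\<bar> < arccot z"
    using remainder_le_far[OF assms(2,3) z_def] arccot_gt[of z] by linarith
  then show ?thesis by (simp add: z_def abs_minus_commute)
qed

end
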